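(* Let $d \in \mathbb{N}$, let $F \in C^{1}(\mathbb{R}^{d},\mathbb{R})$, let $x \in C^{1}([0,\infty),\mathbb{R}^{d})$ be bounded, let $\|\cdot\| \colon \mathbb{R}^{d} \to [0,\infty)$ be a norm, and assume for all $t \in [0,\infty)$ that $$x'(t) = -(\nabla F)(x(t)).$$ Then: (i) $F(x(t))$ converges in $\mathbb{R}$ as $t \to \infty$; and (ii) $\limsup_{t\to\infty} \|(\nabla F)(x(t))\| = 0$.
   Context: $\mathbb{N}=\{1,2,3,\dots\}$. $C^{1}(A,B)$ denotes the set of continuously differentiable functions from $A$ to $B$ (one-sided derivative at $t=0$ for functions on $[0,\infty)$). $\nabla F$ denotes the usual gradient of $F$ with respect to the standard Euclidean inner product on $\mathbb{R}^{d}$ (the vector of partial derivatives). *)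

theory Defs
  imports "HOL-Analysis.Analysis"
begin

(* At points of S the derivative is taken within S, so it is one-sided at the end point of
   {0..}. The derivative is continuous as a map into the bounded linear operators. *)
definition C1_on :: "'a::real_normed_vector set \<Rightarrow> ('a \<Rightarrow> 'b::real_normed_vector) \<Rightarrow> bool" where
  "C1_on S f \<longleftrightarrow>
     (\<exists>f' :: 'a \<Rightarrow> 'a \<Rightarrow>\<^sub>L 'b.
        (\<forall>x\<in>S. (f has_derivative blinfun_apply (f' x)) (at x within S)) \<and>
        continuous_on S f')"

definition gradient :: "(real ^ 'd \<Rightarrow> real) \<Rightarrow> real ^ 'd \<Rightarrow> real ^ 'd" where
  "gradient F x = (\<chi> i. deriv (\<lambda>h. F (x + h *\<^sub>R axis i 1)) 0)"

definition is_norm :: "('a::real_vector \<Rightarrow> real) \<Rightarrow> bool" where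
  "is_norm N \<longleftrightarrow>
     (\<forall>v. 0 \<le> N v) \<and>
     (\<forall>v. N v = 0 \<longleftrightarrow> v = 0) \<and>
     (\<forall>a v. N (a *\<^sub>R v) = \<bar>a\<bar> * N v) \<and>
     (\<forall>v w. N (v + w) \<le> N v + N w)"

end

theory Submission
  imports Defs
begin

text \<open>
  Along the flow, \<open>F \<circ> x\<close> has derivative \<open>- \<parallel>\<nabla>F (x t)\<parallel>\<^sup>2\<close>, hence decreases; being bounded below on a
  compact set it converges. The gradient is bounded along the trajectory, so \<open>x\<close> is Lipschitz and
  \<open>\<nabla>F \<circ> x\<close> is uniformly continuous. Wherever \<open>\<nabla>F \<circ> x\<close> has norm at least \<open>\<epsilon>\<close>, it stays above \<open>\<epsilon> / 2\<close>
  for a fixed length of time, during which \<open>F \<circ> x\<close> drops by a fixed amount; since \<open>F \<circ> x\<close> converges,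
  this cannot happen at arbitrarily late times.
\<close>

text \<open>Since \<open>gradient\<close> is built from \<open>deriv\<close> along coordinate lines,
  it has to be tied to the total derivative. The chain rule along each line identifies the partial
  derivatives with the values of the derivative at the \<open>axis i 1\<close>, and linearity
  recovers all other directions. Continuity is inherited from the operator-valued
  derivative.\<close>

lemma C1_on_UNIV_gradient:
  fixes F :: "real ^ 'd \<Rightarrow> real"
  assumes "C1_on UNIV F"
  shows "(F has_derivative (\<lambda>v. gradient F y \<bullet> v)) (at y)"
    and "continuous_on UNIV (gradient F)"
proof -
  obtain F' :: "real ^ 'd \<Rightarrow> (real ^ 'd) \<Rightarrow>\<^sub>L real"
    where der: "\<And>y. (F has_derivative F' y) (at y)" and cont: "continuous_on UNIV F'"
    using assms unfolding C1_on_def by auto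
  have grad: "gradient F y = (\<chi> i. F' y (axis i 1))" for y
  proof -
    have "((\<lambda>h. F (y + h *\<^sub>R axis i 1)) has_derivative (\<lambda>h. F' y (h *\<^sub>R axis i 1))) (at 0)" for i
      by (rule has_derivative_compose[where g = F and f = "\<lambda>h. y + h *\<^sub>R axis i 1"])
        (auto intro!: derivative_eq_intros der)
    then have "((\<lambda>h. F (y + h *\<^sub>R axis i 1)) has_field_derivative F' y (axis i 1)) (at 0)" for i
      by (simp add: has_field_derivative_def blinfun.scaleR_right mult_commute_abs)
    from DERIV_imp_deriv[OF this] show ?thesis
      unfolding gradient_def by simp
  qed
  have "F' y v = gradient F y \<bullet> v" for v
  proof -
    have "F' y v = F' y (\<Sum>i\<in>UNIV. v $ i *\<^sub>R axis i 1)"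
      using basis_expansion[of v] by (simp add: scalar_mult_eq_scaleR)
    then show ?thesis
      by (simp add: grad inner_vec_def blinfun.sum_right blinfun.scaleR_right mult.commute)
  qed
  then have "blinfun_apply (F' y) = (\<lambda>v. gradient F y \<bullet> v)"
    by auto
  with der[of y] show "(F has_derivative (\<lambda>v. gradient F y \<bullet> v)) (at y)"
    by simp
  show "continuous_on UNIV (gradient F)"
    unfolding grad by (intro continuous_intros cont)
qed

text \<open>This half of the equivalence of norms transfers convergence to 0 from the Euclidean norm
  to \<open>N\<close>. Expanding \<open>v\<close> in the standard basis, the triangle inequality and
  homogeneity allow \<open>C\<close> to be the sum of the values of \<open>N\<close> on the basis
  vectors.\<close>

lemma is_norm_le_norm:
  fixes N :: "real ^ 'd \<Rightarrow> real"
  assumes "is_norm N"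
  shows "\<exists>C. \<forall>v. N v \<le> C * norm v"
proof (intro exI allI)
  fix v :: "real ^ 'd"
  have scale: "\<And>a v. N (a *\<^sub>R v) = \<bar>a\<bar> * N v" and tri: "\<And>v w. N (v + w) \<le> N v + N w"
    and zero: "N 0 = 0" and pos: "\<And>v. 0 \<le> N v"
    using assms unfolding is_norm_def by auto
  have sum_le: "N (\<Sum>i\<in>A. g i) \<le> (\<Sum>i\<in>A. N (g i))" if "finite A" for A :: "'d set" and g
    using that by induction (auto simp: zero intro: order_trans[OF tri])
  have "N v = N (\<Sum>i\<in>UNIV. v $ i *\<^sub>R axis i 1)"
    using basis_expansion[of v] by (simp add: scalar_mult_eq_scaleR)
  also have "\<dots> \<le> (\<Sum>i\<in>UNIV. \<bar>v $ i\<bar> * N (axis i 1))"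
    using sum_le[of UNIV "\<lambda>i. v $ i *\<^sub>R axis i 1"] by (simp add: scale)
  also have "\<dots> \<le> (\<Sum>i\<in>UNIV. norm v * N (axis i 1))"
    by (intro sum_mono mult_right_mono component_le_norm_cart pos)
  finally show "N v \<le> (\<Sum>i\<in>UNIV. N (axis i 1)) * norm v"
    by (simp add: sum_distrib_left mult.commute)
qed

lemma antimono_bounded_below_tendsto:
  fixes f :: "real \<Rightarrow> real"
  assumes anti: "\<And>s t. a \<le> s \<Longrightarrow> s \<le> t \<Longrightarrow> f t \<le> f s"
    and bdd: "bdd_below (f ` {a..})"
  shows "(f \<longlongrightarrow> (INF t\<in>{a..}. f t)) at_top"
proof (rule order_tendstoI)
  fix l assume "l < (INF t\<in>{a..}. f t)"
  then show "\<forall>\<^sub>F t in at_top. l < f t"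
    by (intro eventually_mono[OF eventually_ge_at_top[of a]])
      (auto intro: less_le_trans cINF_lower[OF bdd])
next
  fix u assume "(INF t\<in>{a..}. f t) < u"
  then obtain s where "a \<le> s" "f s < u"
    using cINF_less_iff[OF _ bdd] by auto
  then show "\<forall>\<^sub>F t in at_top. f t < u"
    by (intro eventually_mono[OF eventually_ge_at_top[of s]]) (auto intro: le_less_trans anti)
qed

text \<open>Derivatives within \<open>{a..}\<close> restrict to derivatives within
  \<open>{s..t}\<close>, so the mean value theorem applies even when \<open>s = a\<close>, where
  only a one-sided derivative is given.\<close>

lemma mvt_atLeast:
  fixes f :: "real \<Rightarrow> real"
  assumes der: "\<And>z. z \<ge> a \<Longrightarrow> (f has_real_derivative f' z) (at z within {a..})"
    and "a \<le> s" "s < t"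
  shows "\<exists>z\<in>{s<..<t}. f t - f s = (t - s) * f' z"
proof -
  have "(f has_derivative (\<lambda>u. u * f' z)) (at z within {s..t})" if "s \<le> z" for z
    using has_field_derivative_subset[OF der, of z "{s..t}"] that assms(2)
    by (auto simp: has_field_derivative_def mult_commute_abs)
  from mvt_simple[OF assms(3) this] show ?thesis
    by auto
qed

text \<open>A form of Barbalat's lemma that avoids integrating \<open>\<parallel>g\<parallel>\<^sup>2\<close>.\<close>

lemma dissipation_tendsto_zero:
  fixes f :: "real \<Rightarrow> real" and g :: "real \<Rightarrow> 'a::real_normed_vector"
  assumes der: "\<And>t. t \<ge> 0 \<Longrightarrow> (f has_real_derivative - (norm (g t))\<^sup>2) (at t within {0..})"
    and uc: "uniformly_continuous_on {0..} g"
    and lim: "(f \<longlongrightarrow> L) at_top"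
  shows "(g \<longlongrightarrow> 0) at_top"
proof (rule tendstoI)
  fix e :: real assume e: "e > 0"
  then obtain d where d: "d > 0"
    and close: "\<And>s t. 0 \<le> s \<Longrightarrow> 0 \<le> t \<Longrightarrow> dist s t < d \<Longrightarrow> dist (g s) (g t) < e / 2"
    using uc unfolding uniformly_continuous_on_def by (metis atLeast_iff half_gt_zero)
  define h where "h = d / 2"
  have h: "0 < h" "h < d" using d by (auto simp: h_def)
  have "filterlim (\<lambda>t. h + t) at_top at_top"
    by (rule filterlim_tendsto_add_at_top[OF tendsto_const filterlim_ident])
  \<comment> \<open>A convergent function has vanishing increments over windows of the fixed length
    \<open>h\<close>.\<close>
  from tendsto_diff[OF lim filterlim_compose[OF lim this]]
  have "((\<lambda>t. f t - f (h + t)) \<longlongrightarrow> 0) at_top"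
    by simp
  moreover have "0 < h * (e / 2)\<^sup>2" using h e by simp
  ultimately have "\<forall>\<^sub>F t in at_top. f t - f (h + t) < h * (e / 2)\<^sup>2"
    by (rule order_tendstoD)
  then show "\<forall>\<^sub>F t in at_top. dist (g t) 0 < e"
    using eventually_ge_at_top[of 0]
  proof eventually_elim
    case (elim t)
    \<comment> \<open>The drop of \<open>f\<close> over the window is \<open>h\<close> times the
      squared norm of \<open>g\<close> at some interior \<open>z\<close>. The threshold
      \<open>h * (e / 2)\<^sup>2\<close> thus forces \<open>norm (g z) < e / 2\<close>, and uniform
      continuity carries the bound from \<open>z\<close> back to \<open>t\<close> at the cost of
      another \<open>e / 2\<close>.\<close>
    from h elim obtain z where "t < z" "z < h + t"
      "f (h + t) - f t = (h + t - t) * - (norm (g z))\<^sup>2"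
      using mvt_atLeast[OF der, of t "h + t"] by auto
    then have z: "t < z" "z < h + t" "f t - f (h + t) = h * (norm (g z))\<^sup>2"
      by auto
    with elim h have "(norm (g z))\<^sup>2 < (e / 2)\<^sup>2"
      by simp
    then have "norm (g z) < e / 2"
      by (rule power2_less_imp_less) (use e in simp)
    moreover have "dist (g t) (g z) < e / 2"
      using z elim h by (intro close) (auto simp: dist_real_def)
    ultimately show ?case
      using dist_triangle[of "g t" 0 "g z"] by simp
  qed
qed

theorem theorem2:
  fixes F :: "real ^ 'd \<Rightarrow> real"
    and x :: "real \<Rightarrow> real ^ 'd"
    and N :: "real ^ 'd \<Rightarrow> real"
  assumes "C1_on UNIV F"
    and "C1_on {0..} x"
    and "bounded (x ` {0..})"
    and "is_norm N"
    and "\<And>t. t \<ge> 0 \<Longrightarrow> vector_derivative x (at t within {0..}) = - gradient F (x t)"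
  shows "(\<exists>L::real. ((\<lambda>t. F (x t)) \<longlongrightarrow> L) at_top) \<and>
         Limsup at_top (\<lambda>t. ereal (N (gradient F (x t)))) = 0"
proof -
  let ?G = "gradient F" and ?K = "closure (x ` {0..})"
  note F_der = C1_on_UNIV_gradient(1)[OF assms(1)] and G_cont = C1_on_UNIV_gradient(2)[OF assms(1)]
  \<comment> \<open>The closure of a bounded trajectory is compact by Heine-Borel. This bounds
    \<open>F\<close> and \<open>?G\<close> along \<open>x\<close> and makes \<open>?G\<close>
    uniformly continuous there.\<close>
  have K: "compact ?K"
    using assms(3) by (simp add: compact_closure)
  have inK: "x t \<in> ?K" if "t \<ge> 0" for t
    using that closure_subset by fastforce

  have x_der: "(x has_vector_derivative - ?G (x t)) (at t within {0..})" if "t \<ge> 0" for t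
  proof -
    \<comment> \<open>\<open>vector_derivative\<close> is a choice operator, so the flow equation
      says something about the actual derivative only once differentiability is known.\<close>
    have "x differentiable (at t within {0..})"
      using assms(2) that unfolding C1_on_def differentiable_def by blast
    then show ?thesis
      using assms(5)[OF that] by (simp add: vector_derivative_works)
  qed
  have Fx_der: "((\<lambda>t. F (x t)) has_real_derivative - (norm (?G (x t)))\<^sup>2) (at t within {0..})"
    if "t \<ge> 0" for t
    unfolding has_field_derivative_def
    by (rule has_derivative_eq_rhs[OF has_derivative_compose[OF
            x_der[OF that, unfolded has_vector_derivative_def] F_der]])
      (auto simp: power2_norm_eq_inner)

  have "F (x t) \<le> F (x s)" if "0 \<le> s" "s \<le> t" for s t
  proof (cases "s = t")
    case False
    with that obtain z where "F (x t) - F (x s) = (t - s) * - (norm (?G (x z)))\<^sup>2"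
      using mvt_atLeast[OF Fx_der, of s t] by auto
    moreover have "0 \<le> (t - s) * (norm (?G (x z)))\<^sup>2"
      using that by simp
    ultimately show ?thesis by simp
  qed simp
  moreover have "bdd_below ((\<lambda>t. F (x t)) ` {0..})"
  proof -
    have "continuous_on ?K F"
      by (meson F_der continuous_at_imp_continuous_on has_derivative_continuous)
    then have "bdd_below (F ` ?K)"
      by (intro bounded_imp_bdd_below compact_imp_bounded compact_continuous_image K)
    then show ?thesis
      by (rule bdd_below_mono) (auto intro: inK)
  qed
  ultimately have Fx_lim: "((\<lambda>t. F (x t)) \<longlongrightarrow> (INF t\<in>{0..}. F (x t))) at_top"
    by (rule antimono_bounded_below_tendsto)

  have "bounded (?G ` ?K)"
    by (intro compact_imp_bounded compact_continuous_image K continuous_on_subset[OF G_cont]) simp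
  then obtain M where M: "0 < M" "\<And>y. y \<in> ?K \<Longrightarrow> norm (?G y) \<le> M"
    by (auto simp: bounded_pos)
  \<comment> \<open>By the flow equation the speed of \<open>x\<close> is the norm of
    \<open>?G (x t)\<close>, at most \<open>M\<close>; the mean value inequality applies on the
    convex set \<open>{0..}\<close>.\<close>
  have "M-lipschitz_on {0..} x"
  proof (rule lipschitz_onI)
    fix s t :: real assume "s \<in> {0..}" "t \<in> {0..}"
    then show "dist (x s) (x t) \<le> M * dist s t"
      unfolding dist_norm
      by (intro differentiable_bound[where S = "{0..}" and f' = "\<lambda>t h. h *\<^sub>R - ?G (x t)"])
        (use x_der M inK in \<open>auto simp: has_vector_derivative_def onorm_scaleR_left
            onorm_id simp del: scaleR_minus_right\<close>)
  qed (use M in simp)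
  then have "uniformly_continuous_on {0..} x"
    by (rule lipschitz_on_uniformly_continuous)
  moreover have "uniformly_continuous_on (x ` {0..}) ?G"
    using compact_uniformly_continuous[OF continuous_on_subset[OF G_cont subset_UNIV] K] closure_subset
    unfolding uniformly_continuous_on_def by (meson subsetD)
  ultimately have "uniformly_continuous_on {0..} (\<lambda>t. ?G (x t))"
    by (rule uniformly_continuous_on_compose)
  from dissipation_tendsto_zero[OF Fx_der this Fx_lim]
  have G_lim: "((\<lambda>t. ?G (x t)) \<longlongrightarrow> 0) at_top" .

  obtain C where C: "\<And>v. N v \<le> C * norm v"
    using is_norm_le_norm[OF assms(4)] by auto
  have "((\<lambda>t. N (?G (x t))) \<longlongrightarrow> 0) at_top"
  proof (rule tendsto_sandwich[OF _ _ tendsto_const])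
    show "((\<lambda>t. C * norm (?G (x t))) \<longlongrightarrow> 0) at_top"
      using tendsto_mult_right_zero[OF tendsto_norm_zero[OF G_lim]] .
    show "\<forall>\<^sub>F t in at_top. 0 \<le> N (?G (x t))"
      using assms(4) unfolding is_norm_def by (intro always_eventually) blast
  qed (rule always_eventually, rule allI, rule C)
  then have "((\<lambda>t. ereal (N (?G (x t)))) \<longlongrightarrow> ereal 0) at_top"
    by (intro tendsto_intros)
  \<comment> \<open>The limit exists and \<open>at_top\<close> is a nontrivial filter, so the upper
    limit equals the limit.\<close>
  then have "Limsup at_top (\<lambda>t. ereal (N (?G (x t)))) = 0"
    by (simp add: lim_imp_Limsup zero_ereal_def)
  with Fx_lim show ?thesis by blast
qed

end
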